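(* Let $X$ and $Y$ be topological spaces such that the product $X\times Y$ is $\mathbb R$-factorizable and $Y$ is not pseudo-$\aleph_1$-compact. Then (1) $X^\omega$ is hereditarily Lindelöf and hereditarily separable; (2) if $w(X)\leq \omega_1$, then $X$ is second-countable; (3) under $\mathrm{CH}$ (the continuum hypothesis), $X$ is second-countable.
   Context: All topological spaces are assumed to be Tychonoff (including Hausdorff). A product $X\times Y$ of topological spaces is (multiplicatively) $\mathbb R$-factorizable if for any continuous function $f\colon X\times Y\to\mathbb R$ there exist second-countable spaces $X',Y'$ and continuous maps $g_1\colon X\to X'$, $g_2\colon Y\to Y'$, and $h\colon X'\times Y'\to\mathbb R$ such that $f=h\circ(g_1\times g_2)$. A space is pseudo-$\aleph_1$-compact if any locally finite (equivalently, any discrete) family of open sets in it is at most countable. $w(X)$ is the weight of $X$; $X^\omega$ carries the product topology. *)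

theory Defs
  imports "HOL-Analysis.Analysis"
begin

unbundle cardinal_syntax

definition tychonoff_space :: "'a topology \<Rightarrow> bool" where
  "tychonoff_space X \<longleftrightarrow> completely_regular_space X \<and> Hausdorff_space X"

(* The second-countable factors range over topologies whose points are real numbers. This is no
   restriction: a second-countable Hausdorff space has at most continuum many points, so it is
   homeomorphic to one whose points are reals; see R_factorizable_prodI below. *)
definition R_factorizable_prod :: "'a topology \<Rightarrow> 'b topology \<Rightarrow> bool" where
  "R_factorizable_prod X Y \<longleftrightarrow>
    (\<forall>f. continuous_map (prod_topology X Y) euclideanreal f \<longrightarrow>
      (\<exists>(X' :: real topology) (Y' :: real topology) g1 g2 h.
        tychonoff_space X' \<and> second_countable X' \<and>
        tychonoff_space Y' \<and> second_countable Y' \<and>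
        continuous_map X X' g1 \<and> continuous_map Y Y' g2 \<and>
        continuous_map (prod_topology X' Y') euclideanreal h \<and>
        (\<forall>x \<in> topspace X. \<forall>y \<in> topspace Y. f (x, y) = h (g1 x, g2 y))))"

definition pseudo_aleph1_compact :: "'a topology \<Rightarrow> bool" where
  "pseudo_aleph1_compact X \<longleftrightarrow>
    (\<forall>\<U>. (\<forall>U \<in> \<U>. openin X U) \<and> locally_finite_in X \<U> \<longrightarrow> countable \<U>)"

definition is_base :: "'a topology \<Rightarrow> 'a set set \<Rightarrow> bool" where
  "is_base X \<B> \<longleftrightarrow> (\<forall>B \<in> \<B>. openin X B) \<and>
    (\<forall>U x. openin X U \<and> x \<in> U \<longrightarrow> (\<exists>B \<in> \<B>. x \<in> B \<and> B \<subseteq> U))"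

(* Least cardinality of a base, as a cardinal order; well-defined up to =o by ex_minimal_base. *)
definition weight :: "'a topology \<Rightarrow> 'a set rel" where
  "weight X = |SOME \<B>. is_base X \<B> \<and> (\<forall>\<C>. is_base X \<C> \<longrightarrow> |\<B>| \<le>o |\<C>| )|"

abbreviation omega1 :: "nat set rel" where
  "omega1 \<equiv> cardSuc natLeq"

definition CH :: bool where
  "CH \<longleftrightarrow> |UNIV :: nat set set| =o omega1"

lemma ex_minimal_base:
  "\<exists>\<B>. is_base X \<B> \<and> (\<forall>\<C>. is_base X \<C> \<longrightarrow> |\<B>| \<le>o |\<C>| )"
proof -
  let ?R = "card_of ` {\<B>. is_base X \<B>}"
  have "is_base X {U. openin X U}"
    by (auto simp: is_base_def)
  then have "?R \<noteq> {}" by blast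
  moreover have "\<forall>r \<in> ?R. Card_order r"
    using card_of_Card_order by blast
  ultimately obtain r where "r \<in> ?R" "\<forall>r' \<in> ?R. r \<le>o r'"
    using exists_minim_Card_order by meson
  then show ?thesis by auto
qed

lemma weight_ordLeq_iff: "weight X \<le>o r \<longleftrightarrow> (\<exists>\<B>. is_base X \<B> \<and> |\<B>| \<le>o r)"
  using someI_ex[OF ex_minimal_base[of X]] unfolding weight_def
  by (meson ordLeq_transitive)

lemma second_countable_iff_base: "second_countable X \<longleftrightarrow> (\<exists>\<B>. countable \<B> \<and> is_base X \<B>)"
  by (auto simp: second_countable_def is_base_def)

lemma second_countable_Hausdorff_homeomorphic_real:
  fixes Z :: "'c topology"
  assumes "second_countable Z" "Hausdorff_space Z"
  obtains W :: "real topology" where "Z homeomorphic_space W"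
proof -
  obtain \<B> where cB: "countable \<B>" and base: "is_base Z \<B>"
    using assms(1) second_countable_iff_base by blast
  obtain r :: "nat set \<Rightarrow> real" where r: "inj r"
    using nat_sets_eqpoll_reals by (meson bij_betw_def eqpoll_def)
  define e where "e = (\<lambda>z. r {n. z \<in> from_nat_into \<B> n \<and> \<B> \<noteq> {}})"
  have inj: "inj_on e (topspace Z)"
  proof (rule inj_onI)
    fix x y assume x: "x \<in> topspace Z" and y: "y \<in> topspace Z" and "e x = e y"
    then have eq: "{n. x \<in> from_nat_into \<B> n \<and> \<B> \<noteq> {}} = {n. y \<in> from_nat_into \<B> n \<and> \<B> \<noteq> {}}"
      using r by (simp add: e_def inj_eq)
    show "x = y"
    proof (rule ccontr)
      assume "x \<noteq> y"
      then obtain U where U: "openin Z U" "x \<in> U" "y \<notin> U"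
        using assms(2) x y by (metis Hausdorff_space_def disjnt_iff)
      then obtain B where B: "B \<in> \<B>" "x \<in> B" "y \<notin> B"
        using base unfolding is_base_def by blast
      then obtain n where "from_nat_into \<B> n = B"
        using cB from_nat_into_surj by metis
      with B eq show False by blast
    qed
  qed
  define d where "d = inv_into (topspace Z) e"
  have de: "d (e z) = z" if "z \<in> topspace Z" for z
    using inj that by (simp add: d_def)
  define W where "W = pullback_topology (e ` topspace Z) d Z"
  have top: "topspace W = e ` topspace Z"
    using de by (auto simp: W_def topspace_pullback_topology)
  have "continuous_map W Z d"
    unfolding W_def using continuous_map_pullback[OF continuous_map_id] by simp
  moreover have "continuous_map Z W e"
    unfolding W_def
  proof (rule continuous_map_pullback')
    show "continuous_map Z Z (d \<circ> e)"
      by (rule continuous_map_eq[OF continuous_map_id]) (simp add: de)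
  qed auto
  ultimately have "homeomorphic_maps Z W e d"
    using de top by (auto simp: homeomorphic_maps_def)
  then show thesis
    using that homeomorphic_space_def by blast
qed

lemma R_factorizable_prodI:
  fixes X :: "'a topology" and Y :: "'b topology"
  assumes "\<And>f. continuous_map (prod_topology X Y) euclideanreal f \<Longrightarrow>
      \<exists>(X' :: 'c topology) (Y' :: 'd topology) g1 g2 h.
        tychonoff_space X' \<and> second_countable X' \<and>
        tychonoff_space Y' \<and> second_countable Y' \<and>
        continuous_map X X' g1 \<and> continuous_map Y Y' g2 \<and>
        continuous_map (prod_topology X' Y') euclideanreal h \<and>
        (\<forall>x \<in> topspace X. \<forall>y \<in> topspace Y. f (x, y) = h (g1 x, g2 y))"
  shows "R_factorizable_prod X Y"
  unfolding R_factorizable_prod_def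
proof (intro allI impI)
  fix f assume "continuous_map (prod_topology X Y) euclideanreal f"
  then obtain X' :: "'c topology" and Y' :: "'d topology" and g1 g2 h where
    X': "tychonoff_space X'" "second_countable X'" and
    Y': "tychonoff_space Y'" "second_countable Y'" and
    g1: "continuous_map X X' g1" and g2: "continuous_map Y Y' g2" and
    h: "continuous_map (prod_topology X' Y') euclideanreal h" and
    f: "\<forall>x \<in> topspace X. \<forall>y \<in> topspace Y. f (x, y) = h (g1 x, g2 y)"
    using assms by metis
  obtain V :: "real topology" where V: "X' homeomorphic_space V"
    using X' second_countable_Hausdorff_homeomorphic_real tychonoff_space_def by metis
  obtain W :: "real topology" where W: "Y' homeomorphic_space W"
    using Y' second_countable_Hausdorff_homeomorphic_real tychonoff_space_def by metis
  obtain a b where ab: "homeomorphic_maps X' V a b"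
    using V homeomorphic_space_def by blast
  obtain c d where cd: "homeomorphic_maps Y' W c d"
    using W homeomorphic_space_def by blast
  let ?h = "h \<circ> (\<lambda>p. (b (fst p), d (snd p)))"
  have "tychonoff_space V" "second_countable V" "tychonoff_space W" "second_countable W"
    using X' Y' V W homeomorphic_completely_regular_space homeomorphic_Hausdorff_space
      homeomorphic_space_second_countability unfolding tychonoff_space_def by blast+
  moreover have "continuous_map X V (a \<circ> g1)" "continuous_map Y W (c \<circ> g2)"
    using ab cd g1 g2 by (auto simp: homeomorphic_maps_def intro: continuous_map_compose)
  moreover have "continuous_map (prod_topology V W) euclideanreal ?h"
  proof (rule continuous_map_compose[OF _ h])
    have "continuous_map V X' b" "continuous_map W Y' d"
      using ab cd by (auto simp: homeomorphic_maps_def)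
    then show "continuous_map (prod_topology V W) (prod_topology X' Y') (\<lambda>p. (b (fst p), d (snd p)))"
      by (simp add: continuous_map_paired continuous_map_of_fst continuous_map_of_snd o_def
          continuous_map_compose[OF continuous_map_fst, unfolded o_def]
          continuous_map_compose[OF continuous_map_snd, unfolded o_def])
  qed
  moreover have "\<forall>x \<in> topspace X. \<forall>y \<in> topspace Y. f (x, y) = ?h ((a \<circ> g1) x, (c \<circ> g2) y)"
  proof (intro ballI)
    fix x y assume x: "x \<in> topspace X" and y: "y \<in> topspace Y"
    have "g1 x \<in> topspace X'" "g2 y \<in> topspace Y'"
      using x y g1 g2 by (auto simp: continuous_map_def)
    then have "b (a (g1 x)) = g1 x" "d (c (g2 y)) = g2 y"
      using ab cd by (auto simp: homeomorphic_maps_def)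
    then show "f (x, y) = ?h ((a \<circ> g1) x, (c \<circ> g2) y)"
      using f x y by simp
  qed
  ultimately show "\<exists>(X' :: real topology) (Y' :: real topology) g1 g2 h.
        tychonoff_space X' \<and> second_countable X' \<and>
        tychonoff_space Y' \<and> second_countable Y' \<and>
        continuous_map X X' g1 \<and> continuous_map Y Y' g2 \<and>
        continuous_map (prod_topology X' Y') euclideanreal h \<and>
        (\<forall>x \<in> topspace X. \<forall>y \<in> topspace Y. f (x, y) = h (g1 x, g2 y))"
    by blast
qed

end

theory Submission
  imports Defs "HOL-Library.Countable_Set_Type"
begin

text \<open>Since \<open>Y\<close> is not pseudo-\<open>\<aleph>\<^sub>1\<close>-compact, it carries an uncountable locally finite family of bump
  functions \<open>\<phi>\<^sub>V\<close> and points \<open>y\<^sub>V\<close> with \<open>\<phi>\<^sub>V(y\<^sub>W) = \<delta>\<^sub>V\<^sub>W\<close>. Factoring \<open>\<Sum> f\<^sub>V(x) \<phi>\<^sub>V(y)\<close> and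
  restricting to \<open>y = y\<^sub>V\<close> shows that any \<open>\<omega>\<^sub>1\<close> many continuous functions \<open>f\<^sub>V\<close> on \<open>X\<close> factor through
  a single map to a second-countable space. Pulling back a base of that space yields, for any
  \<open>\<omega>\<^sub>1\<close> many points with open neighbourhoods, a countable family of open sets that contains a set
  between each point and its neighbourhood. This property passes to \<open>X\<^sup>\<omega>\<close> and forbids uncountable
  left- and right-separated families, hence (1). For (2), apply the factorization to functions
  separating the pairs of a base of size \<open>\<omega>\<^sub>1\<close>. For (3), a separable regular space has weight at
  most the continuum, because its regular open sets form a base.\<close>

subsection \<open>Cardinality at most \<open>\<omega>\<^sub>1\<close>\<close>

lemma Card_order_omega1: "Card_order omega1"
  using cardSuc_Card_order natLeq_Card_order by blast

lemma infinite_Field_omega1: "infinite (Field omega1)"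
  using cardSuc_finite[OF natLeq_Card_order] by (simp add: Field_natLeq)

lemma countable_imp_ordLeq_omega1: "countable A \<Longrightarrow> |A| \<le>o omega1"
  using countable_card_le_natLeq cardSuc_ordLeq natLeq_Card_order ordLeq_transitive by blast

lemma uncountable_imp_omega1_ordLeq:
  assumes "uncountable A"
  shows "omega1 \<le>o |A|"
proof -
  have "natLeq <o |A|"
    using assms by (metis Card_order_iff_ordLeq_card_of card_of_Well_order countable_card_le_natLeq
        natLeq_Well_order not_ordLeq_iff_ordLess)
  then show ?thesis
    by (rule cardSuc_least[OF natLeq_Card_order card_of_Card_order])
qed

lemma uncountable_Field_omega1: "uncountable (Field omega1)"
proof
  assume "countable (Field omega1)"
  then have "omega1 \<le>o natLeq"
    by (metis Card_order_omega1 card_of_Field_ordIso countable_card_le_natLeq ordIso_ordLeq_trans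
        ordIso_symmetric)
  then show False
    using cardSuc_greater natLeq_Card_order not_ordLess_ordLeq by blast
qed

lemma countable_underS_omega1: "countable (underS omega1 \<alpha>)"
proof (cases "\<alpha> \<in> Field omega1")
  case True
  then have "|underS omega1 \<alpha>| <o omega1"
    by (simp add: Card_order_omega1 card_of_underS)
  then show ?thesis
    using cardSuc_ordLeq_ordLess[OF natLeq_Card_order card_of_Card_order] countable_card_le_natLeq
    by blast
next
  case False
  \<comment> \<open>Indices outside the field have no predecessors, so the bound holds for every
    index of the type and \<open>omega1_recursion\<close> can run over all of them.\<close>
  then have "underS omega1 \<alpha> = {}"
    by (auto simp: underS_def Field_def)
  then show ?thesis
    by simp
qed

text \<open>Well-founded recursion in which stage \<alpha> sees only the set of earlier values. That
  set is countable because initial segments of \<open>omega1\<close> are, and membership in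
  \<open>T\<close> is carried along so that the hypothesis applies again.\<close>

lemma omega1_recursion:
  assumes "\<And>A. countable A \<Longrightarrow> A \<subseteq> T \<Longrightarrow> \<exists>t\<in>T. Q A t"
  shows "\<exists>p. \<forall>\<alpha>. p \<alpha> \<in> T \<and> Q (p ` underS omega1 \<alpha>) (p \<alpha>)"
proof (rule dependent_wf_choice)
  show "wf (omega1 - Id)"
    using Card_order_omega1 by (auto simp: card_order_on_def well_order_on_def)
  show "(r \<in> T \<and> Q (f ` underS omega1 \<alpha>) r) = (r \<in> T \<and> Q (g ` underS omega1 \<alpha>) r)"
    if "\<And>\<beta>. (\<beta>, \<alpha>) \<in> omega1 - Id \<Longrightarrow> f \<beta> = g \<beta>" for f g r \<alpha>
  proof -
    have "f ` underS omega1 \<alpha> = g ` underS omega1 \<alpha>"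
      using that by (intro image_cong) (auto simp: underS_def)
    then show ?thesis by simp
  qed
  show "\<exists>r. r \<in> T \<and> Q (f ` underS omega1 \<alpha>) r"
    if "\<And>\<beta>. (\<beta>, \<alpha>) \<in> omega1 - Id \<Longrightarrow> f \<beta> \<in> T \<and> Q (f ` underS omega1 \<beta>) (f \<beta>)" for f \<alpha>
  proof -
    have "f ` underS omega1 \<alpha> \<subseteq> T"
      using that by (auto simp: underS_def)
    moreover have "countable (f ` underS omega1 \<alpha>)"
      using countable_underS_omega1 by (rule countable_image)
    ultimately show ?thesis
      using assms[of "f ` underS omega1 \<alpha>"] by blast
  qed
qed

section \<open>Free sets for relations with finite out-degree\<close>

text \<open>Read \<open>R\<close> as a directed graph with loops allowed. Some bound
  \<open>n\<close> on the out-degree holds on an uncountable part of \<open>J\<close>, so induction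
  on \<open>n\<close> suffices: a maximal independent set is either uncountable or attracts edges
  from uncountably many vertices, and fixing a common target lowers the out-degree.\<close>

lemma uncountable_independent_subset:
  assumes "uncountable J" and "\<And>a. a \<in> J \<Longrightarrow> finite {b \<in> J. R a b}"
  shows "\<exists>K\<subseteq>J. uncountable K \<and> (\<forall>a\<in>K. \<forall>b\<in>K. R a b \<longrightarrow> a = b)"
proof -
  have bounded: "\<exists>K\<subseteq>J. uncountable K \<and> (\<forall>a\<in>K. \<forall>b\<in>K. R a b \<longrightarrow> a = b)"
    if "uncountable J" "\<And>a. a \<in> J \<Longrightarrow> finite {b \<in> J. R a b} \<and> card {b \<in> J. R a b} \<le> n" for J n
    using that
  proof (induction n arbitrary: J)
    case 0
    have "{b \<in> J. R a b} = {}" if "a \<in> J" for a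
      using "0.prems"(2)[OF that] by (metis card_0_eq le_zero_eq)
    then have "\<forall>a\<in>J. \<forall>b\<in>J. \<not> R a b"
      by blast
    then show ?case
      using "0.prems"(1) by blast
  next
    case (Suc n)
    let ?I = "{K. K \<subseteq> J \<and> (\<forall>a\<in>K. \<forall>b\<in>K. R a b \<longrightarrow> a = b)}"
    have "\<exists>M\<in>?I. \<forall>K\<in>?I. M \<subseteq> K \<longrightarrow> K = M"
    proof (rule subset_Zorn')
      fix \<C> assume chain: "subset.chain ?I \<C>"
      have "a = b" if "A \<in> \<C>" "a \<in> A" "B \<in> \<C>" "b \<in> B" "R a b" for A B a b
      proof -
        have "A \<subseteq> B \<or> B \<subseteq> A"
          using chain that(1,3) by (blast dest: subset.chain_total)
        moreover have "A \<in> ?I" "B \<in> ?I"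
          using chain that(1,3) by (auto simp only: subset.chain_def)
        ultimately show ?thesis
          using that(2,4,5) by blast
      qed
      moreover have "\<Union>\<C> \<subseteq> J"
        using chain by (auto simp: subset.chain_def)
      ultimately show "\<Union>\<C> \<in> ?I"
        by blast
    qed
    then obtain M where "M \<in> ?I" and max: "\<forall>K\<in>?I. M \<subseteq> K \<longrightarrow> K = M"
      by (rule bexE)
    then have M: "M \<subseteq> J" "\<forall>a\<in>M. \<forall>b\<in>M. R a b \<longrightarrow> a = b"
      by simp_all
    show ?case
    proof (cases "countable M")
      case False
      then show ?thesis using M by blast
    next
      case True
      let ?N = "M \<union> (\<Union>k\<in>M. {b \<in> J. R k b})"
      have "countable ?N"
        using True M(1) Suc.prems(2) by (intro countable_Un countable_UN) (auto intro: countable_finite)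
      then have unc: "uncountable (J - ?N)"
        using Suc.prems(1) uncountable_minus_countable by blast
      \<comment> \<open>\<open>a\<close> avoids \<open>?N\<close>, so no edge runs from
        \<open>M\<close> to \<open>a\<close>. By maximality of \<open>M\<close>, some edge must then
        run from \<open>a\<close> into \<open>M\<close>.\<close>
      have "\<exists>k\<in>M. R a k" if a: "a \<in> J - ?N" for a
      proof (rule ccontr)
        assume "\<not> (\<exists>k\<in>M. R a k)"
        then have "insert a M \<in> ?I"
          using a M by auto
        then have "insert a M = M"
          using bspec[OF max] subset_insertI[of M a] by simp
        with a show False by blast
      qed
      then have "J - ?N = (\<Union>k\<in>M. {a \<in> J - ?N. R a k})"
        by blast
      \<comment> \<open>Pigeonhole: an uncountable set split into countably many pieces has an
        uncountable piece.\<close>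
      then obtain k where k: "k \<in> M" "uncountable {a \<in> J - ?N. R a k}"
        using unc True by (metis (no_types, lifting) countable_UN)
      let ?J = "{a \<in> J - ?N. R a k}"
      \<comment> \<open>Out-degrees within \<open>?J\<close> drop, as every \<open>a \<in> ?J\<close> loses its edge to \<open>k \<notin> ?J\<close>.\<close>
      have "\<exists>K\<subseteq>?J. uncountable K \<and> (\<forall>a\<in>K. \<forall>b\<in>K. R a b \<longrightarrow> a = b)"
      proof (rule Suc.IH[OF k(2)])
        fix a assume a: "a \<in> ?J"
        have "{b \<in> ?J. R a b} \<subset> {b \<in> J. R a b}"
          using a k(1) M(1) by blast
        moreover have "finite {b \<in> J. R a b}" "card {b \<in> J. R a b} \<le> Suc n"
          using Suc.prems(2) a by auto
        ultimately show "finite {b \<in> ?J. R a b} \<and> card {b \<in> ?J. R a b} \<le> n"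
          by (meson finite_subset less_Suc_eq_le order_less_le_trans psubset_card_mono psubset_imp_subset)
      qed
      then obtain K where K: "K \<subseteq> ?J" "uncountable K" "\<forall>a\<in>K. \<forall>b\<in>K. R a b \<longrightarrow> a = b"
        by (elim exE conjE)
      from K(1) have "K \<subseteq> J"
        by blast
      with K(2,3) show ?thesis
        by (intro exI[of _ K] conjI)
    qed
  qed
  let ?J = "\<lambda>n. {a \<in> J. card {b \<in> J. R a b} \<le> n}"
  have "\<exists>n. uncountable (?J n)"
  proof (rule ccontr)
    assume "\<not> ?thesis"
    then have "countable (\<Union>n. ?J n)"
      by auto
    moreover have "(\<Union>n. ?J n) = J"
      by auto
    ultimately show False
      using assms(1) by simp
  qed
  then obtain n where n: "uncountable (?J n)"
    by (rule exE)
  have "\<exists>K\<subseteq>?J n. uncountable K \<and> (\<forall>a\<in>K. \<forall>b\<in>K. R a b \<longrightarrow> a = b)"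
  proof (rule bounded[OF n])
    fix a assume a: "a \<in> ?J n"
    have "{b \<in> ?J n. R a b} \<subseteq> {b \<in> J. R a b}" "finite {b \<in> J. R a b}"
      using a assms(2) by auto
    then show "finite {b \<in> ?J n. R a b} \<and> card {b \<in> ?J n. R a b} \<le> n"
      using a by (auto intro: finite_subset card_mono order_trans)
  qed
  then obtain K where K: "K \<subseteq> ?J n" "uncountable K" "\<forall>a\<in>K. \<forall>b\<in>K. R a b \<longrightarrow> a = b"
    by (elim exE conjE)
  from K(1) have "K \<subseteq> J"
    by blast
  with K(2,3) show ?thesis
    by (intro exI[of _ K] conjI)
qed

subsection \<open>Simultaneous factorization of \<open>\<omega>\<^sub>1\<close> many functions\<close>

text \<open>Near each point the sum equals the finite sum over \<open>F z\<close>, and these agree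
  on overlaps, so they paste together. Summing only nonzero terms keeps the index set finite; a sum
  over an infinite set would be 0 by convention.\<close>

lemma continuous_map_locally_finite_sum:
  fixes g :: "'i \<Rightarrow> 'a \<Rightarrow> real"
  assumes cont: "\<And>i. i \<in> I \<Longrightarrow> continuous_map Z euclideanreal (g i)"
    and loc: "\<And>z. z \<in> topspace Z \<Longrightarrow>
      \<exists>N F. openin Z N \<and> z \<in> N \<and> finite F \<and> F \<subseteq> I \<and> (\<forall>w\<in>N. \<forall>i\<in>I - F. g i w = 0)"
  shows "continuous_map Z euclideanreal (\<lambda>z. \<Sum>i | i \<in> I \<and> g i z \<noteq> 0. g i z)"
proof -
  obtain N F where NF: "\<And>z. z \<in> topspace Z \<Longrightarrow>
      openin Z (N z) \<and> z \<in> N z \<and> finite (F z) \<and> F z \<subseteq> I \<and> (\<forall>w\<in>N z. \<forall>i\<in>I - F z. g i w = 0)"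
    using loc by metis
  have eq: "(\<Sum>i | i \<in> I \<and> g i w \<noteq> 0. g i w) = (\<Sum>i\<in>F z. g i w)" if "z \<in> topspace Z" "w \<in> N z" for z w
    using NF[OF that(1)] that(2) by (intro sum.mono_neutral_left) auto
  show ?thesis
  proof (rule pasting_lemma[where I = "topspace Z" and T = N and f = "\<lambda>z w. \<Sum>i\<in>F z. g i w"])
    show "openin Z (N z)" if "z \<in> topspace Z" for z
      using NF that by blast
    show "continuous_map (subtopology Z (N z)) euclideanreal (\<lambda>w. \<Sum>i\<in>F z. g i w)"
      if "z \<in> topspace Z" for z
      using NF[OF that] cont
      by (intro continuous_map_sum continuous_map_from_subtopology) auto
    show "(\<Sum>i\<in>F z. g i w) = (\<Sum>i\<in>F z'. g i w)"
      if "z \<in> topspace Z" "z' \<in> topspace Z" "w \<in> topspace Z \<inter> N z \<inter> N z'" for z z' w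
      using eq[OF that(1), of w] eq[OF that(2), of w] that(3) by simp
    show "\<exists>z'. z' \<in> topspace Z \<and> z \<in> N z' \<and> (\<Sum>i | i \<in> I \<and> g i z \<noteq> 0. g i z) = (\<Sum>i\<in>F z'. g i z)"
      if "z \<in> topspace Z" for z
      using eq NF that by blast
  qed
qed

text \<open>The locally finite family may have overlapping members. A point chosen in each lies in
  only finitely many of them, so \<open>uncountable_independent_subset\<close> leaves an uncountable
  subfamily in which each chosen point lies in its own member alone. Complete regularity then gives
  the bumps.\<close>

lemma not_pseudo_aleph1_compact_bumps:
  assumes "completely_regular_space Y" and "\<not> pseudo_aleph1_compact Y"
  obtains K :: "'b set set" and y :: "'b set \<Rightarrow> 'b" and \<phi> :: "'b set \<Rightarrow> 'b \<Rightarrow> real"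
  where "uncountable K" "locally_finite_in Y K"
    "\<And>V. V \<in> K \<Longrightarrow> y V \<in> topspace Y"
    "\<And>V. V \<in> K \<Longrightarrow> continuous_map Y euclideanreal (\<phi> V)"
    "\<And>V z. V \<in> K \<Longrightarrow> z \<in> topspace Y - V \<Longrightarrow> \<phi> V z = 0"
    "\<And>V W. V \<in> K \<Longrightarrow> W \<in> K \<Longrightarrow> \<phi> V (y W) = (if V = W then 1 else 0)"
proof -
  obtain \<U> where \<U>: "\<And>U. U \<in> \<U> \<Longrightarrow> openin Y U" "locally_finite_in Y \<U>" "uncountable \<U>"
    using assms(2) unfolding pseudo_aleph1_compact_def by blast
  \<comment> \<open>The empty set is dropped so that every member contains a point.\<close>
  define J where "J = \<U> - {{}}"
  have J: "uncountable J" "J \<subseteq> \<U>" "{} \<notin> J"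
    using \<U>(3) by (auto simp: J_def uncountable_minus_countable)
  define y :: "'b set \<Rightarrow> 'b" where "y = (\<lambda>V. SOME z. z \<in> V)"
  have y: "y V \<in> V" if "V \<in> J" for V
    using that J(3) by (metis ex_in_conv someI_ex y_def)
  have "finite {W \<in> J. y V \<in> W}" if "V \<in> J" for V
  proof -
    have "y V \<in> topspace Y"
      using y[OF that] \<U>(1) J(2) that openin_subset by blast
    then obtain N where N: "y V \<in> N" "finite {U \<in> \<U>. U \<inter> N \<noteq> {}}"
      using \<U>(2) unfolding locally_finite_in_def by blast
    show ?thesis
      by (rule finite_subset[OF _ N(2)]) (use J(2) N(1) in auto)
  qed
  then obtain K where K: "K \<subseteq> J" "uncountable K" "\<forall>V\<in>K. \<forall>W\<in>K. y V \<in> W \<longrightarrow> V = W"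
    using uncountable_independent_subset[OF J(1), where R = "\<lambda>V W. y V \<in> W"] by blast
  have op: "openin Y V" and yV: "y V \<in> V" if "V \<in> K" for V
    using that K(1) J(2) \<U>(1) y by auto
  have "\<exists>f. continuous_map Y euclideanreal f \<and> f (y V) = 1 \<and> f ` (topspace Y - V) \<subseteq> {0}" if "V \<in> K" for V
    using assms(1) op[OF that] yV[OF that]
      completely_regular_space_gen_alt'[of 1 "0::real"] by fastforce
  then obtain \<phi> where \<phi>: "\<And>V. V \<in> K \<Longrightarrow> continuous_map Y euclideanreal (\<phi> V) \<and> \<phi> V (y V) = 1
      \<and> \<phi> V ` (topspace Y - V) \<subseteq> {0::real}"
    by metis
  have top: "y V \<in> topspace Y" if "V \<in> K" for V
    using op yV openin_subset that by blast
  show thesis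
  proof (rule that)
    show "uncountable K" by fact
    show "locally_finite_in Y K"
      using \<U>(2) K(1) J(2) locally_finite_in_subset by blast
    show "\<phi> V (y W) = (if V = W then 1 else 0)" if "V \<in> K" "W \<in> K" for V W
      using \<phi>[OF that(1)] top[OF that(2)] K(3) that by (auto simp: image_subset_iff)
  qed (use \<phi> top in \<open>auto simp: image_subset_iff\<close>)
qed

text \<open>A single function \<open>F\<close> on the product encodes the whole family: its slice at
  \<open>y (e i)\<close> is \<open>f i\<close>. Factoring \<open>F\<close> once therefore factors
  all \<open>f i\<close> through the same \<open>g1\<close>.\<close>

lemma R_factorizable_prod_common_factor:
  fixes f :: "'i \<Rightarrow> 'a \<Rightarrow> real"
  assumes "completely_regular_space Y" "R_factorizable_prod X Y" "\<not> pseudo_aleph1_compact Y"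
    and "|I| \<le>o omega1" and f: "\<And>i. i \<in> I \<Longrightarrow> continuous_map X euclideanreal (f i)"
  obtains X' :: "real topology" and g k where "second_countable X'" "continuous_map X X' g"
    "\<And>i. i \<in> I \<Longrightarrow> continuous_map X' euclideanreal (k i)"
    "\<And>i x. i \<in> I \<Longrightarrow> x \<in> topspace X \<Longrightarrow> f i x = k i (g x)"
proof -
  obtain K y \<phi> where K: "uncountable K" "locally_finite_in Y K"
    and y: "\<And>V. V \<in> K \<Longrightarrow> y V \<in> topspace Y"
    and \<phi>: "\<And>V. V \<in> K \<Longrightarrow> continuous_map Y euclideanreal (\<phi> V)"
      "\<And>V z. V \<in> K \<Longrightarrow> z \<in> topspace Y - V \<Longrightarrow> \<phi> V z = 0"
      "\<And>V W. V \<in> K \<Longrightarrow> W \<in> K \<Longrightarrow> \<phi> V (y W) = (if V = W then 1 else 0)"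
    using not_pseudo_aleph1_compact_bumps[OF assms(1,3)] by blast
  have "|I| \<le>o |K|"
    using assms(4) uncountable_imp_omega1_ordLeq[OF K(1)] ordLeq_transitive by blast
  then obtain e where e: "inj_on e I" "e ` I \<subseteq> K"
    by (meson card_of_ordLeq)
  define G where "G = (\<lambda>i p. f i (fst p) * \<phi> (e i) (snd p))"
  define F where "F = (\<lambda>p. \<Sum>i | i \<in> I \<and> G i p \<noteq> 0. G i p)"
  have "continuous_map (prod_topology X Y) euclideanreal F"
    unfolding F_def
  proof (rule continuous_map_locally_finite_sum)
    show "continuous_map (prod_topology X Y) euclideanreal (G i)" if "i \<in> I" for i
    proof -
      have "e i \<in> K"
        using e(2) that by auto
      then show ?thesis
        unfolding G_def
        by (intro continuous_map_real_mult
            continuous_map_compose[OF continuous_map_fst f[OF that], unfolded o_def]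
            continuous_map_compose[OF continuous_map_snd \<phi>(1), unfolded o_def])
    qed
    fix p assume p: "p \<in> topspace (prod_topology X Y)"
    then have "snd p \<in> topspace Y"
      by auto
    then obtain N where N: "openin Y N" "snd p \<in> N" "finite {V \<in> K. V \<inter> N \<noteq> {}}"
      using K(2) unfolding locally_finite_in_def by blast
    \<comment> \<open>Local finiteness of \<open>K\<close> transfers to the indices because
      \<open>e\<close> is injective.\<close>
    have "finite {i \<in> I. e i \<inter> N \<noteq> {}}"
    proof (rule finite_imageD)
      show "finite (e ` {i \<in> I. e i \<inter> N \<noteq> {}})"
        by (rule finite_subset[OF _ N(3)]) (use e(2) in auto)
      show "inj_on e {i \<in> I. e i \<inter> N \<noteq> {}}"
        using e(1) by (rule inj_on_subset) auto
    qed
    moreover have "G i w = 0" if "w \<in> topspace X \<times> N" "i \<in> I - {i \<in> I. e i \<inter> N \<noteq> {}}" for i w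
    proof -
      have "snd w \<in> topspace Y - e i" "e i \<in> K"
        using that openin_subset[OF N(1)] e(2) by auto
      then show ?thesis
        by (simp add: G_def \<phi>(2))
    qed
    moreover have "openin (prod_topology X Y) (topspace X \<times> N)" "p \<in> topspace X \<times> N"
      using N p by (auto simp: openin_prod_Times_iff)
    ultimately show "\<exists>N F. openin (prod_topology X Y) N \<and> p \<in> N \<and> finite F \<and> F \<subseteq> I \<and>
        (\<forall>w\<in>N. \<forall>i\<in>I - F. G i w = 0)"
      by (metis (no_types, lifting) mem_Collect_eq subsetI)
  qed
  then obtain X' Y' :: "real topology" and g1 g2 h where X': "second_countable X'"
    and g1: "continuous_map X X' g1" and g2: "continuous_map Y Y' g2"
    and h: "continuous_map (prod_topology X' Y') euclideanreal h"
    and F: "\<And>x y. x \<in> topspace X \<Longrightarrow> y \<in> topspace Y \<Longrightarrow> F (x, y) = h (g1 x, g2 y)"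
    using assms(2) unfolding R_factorizable_prod_def by metis
  show thesis
  proof (rule that[OF X' g1, where k = "\<lambda>i x. h (x, g2 (y (e i)))"])
    fix i assume i: "i \<in> I"
    then have yi: "y (e i) \<in> topspace Y"
      using e(2) y by auto
    then have "g2 (y (e i)) \<in> topspace Y'"
      using g2 by (auto simp: continuous_map_def)
    then show "continuous_map X' euclideanreal (\<lambda>x. h (x, g2 (y (e i))))"
      by (intro continuous_map_compose[OF _ h, unfolded o_def] continuous_map_pairedI) auto
    fix x assume x: "x \<in> topspace X"
    have G: "G j (x, y (e i)) = (if j = i then f i x else 0)" if "j \<in> I" for j
      using that i e \<phi>(3) by (auto simp: G_def inj_on_def image_subset_iff)
    \<comment> \<open>The index set of \<open>F\<close> here is \<open>{i}\<close>, or empty when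
      \<open>f i x = 0\<close>; both give the same sum.\<close>
    have "F (x, y (e i)) = (\<Sum>j\<in>{i}. G j (x, y (e i)))"
      unfolding F_def by (rule sum.mono_neutral_left) (use i G in \<open>auto split: if_splits\<close>)
    then have "F (x, y (e i)) = f i x"
      using G i by simp
    then show "f i x = h (g1 x, g2 (y (e i)))"
      using F x yi by simp
  qed
qed

text \<open>Separating functions for all pairs factor through one map \<open>g\<close> to a
  second-countable space; \<open>\<C>\<close> is the preimage under \<open>g\<close> of a countable
  base. Using sets \<open>A\<close> rather than points serves both singletons, for countable
  refinability, and members of a base, for the weight.\<close>

lemma countable_refinement_of_separated_pairs:
  assumes "completely_regular_space Y" "R_factorizable_prod X Y" "\<not> pseudo_aleph1_compact Y"
    and "|P| \<le>o omega1"
    and sep: "\<And>A U. (A, U) \<in> P \<Longrightarrow> \<exists>f. continuous_map X euclideanreal f \<and>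
      (\<forall>x\<in>A. x \<in> topspace X \<and> 1 \<le> f x) \<and> (\<forall>x\<in>topspace X - U. f x = 0)"
  shows "\<exists>\<C>. countable \<C> \<and> (\<forall>C\<in>\<C>. openin X C) \<and>
    (\<forall>A U x. (A, U) \<in> P \<longrightarrow> x \<in> A \<longrightarrow> (\<exists>C\<in>\<C>. x \<in> C \<and> C \<subseteq> U))"
proof -
  have "\<exists>f. continuous_map X euclideanreal f \<and>
      (\<forall>x\<in>fst p. x \<in> topspace X \<and> 1 \<le> f x) \<and> (\<forall>x\<in>topspace X - snd p. f x = 0)" if "p \<in> P" for p
    using that sep[of "fst p" "snd p"] by simp
  then obtain f where "\<And>p. p \<in> P \<Longrightarrow> continuous_map X euclideanreal (f p) \<and>
      (\<forall>x\<in>fst p. x \<in> topspace X \<and> 1 \<le> f p x) \<and> (\<forall>x\<in>topspace X - snd p. f p x = 0)"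
    by metis
  then have f: "continuous_map X euclideanreal (f (A, U)) \<and>
      (\<forall>x\<in>A. x \<in> topspace X \<and> 1 \<le> f (A, U) x) \<and> (\<forall>x\<in>topspace X - U. f (A, U) x = 0)"
    if "(A, U) \<in> P" for A U
    using that by force
  then have "continuous_map X euclideanreal (f p)" if "p \<in> P" for p
    using that by (cases p) auto
  then obtain X' :: "real topology" and g k where X': "second_countable X'" and g: "continuous_map X X' g"
    and k: "\<And>p. p \<in> P \<Longrightarrow> continuous_map X' euclideanreal (k p)"
    and fk: "\<And>p x. p \<in> P \<Longrightarrow> x \<in> topspace X \<Longrightarrow> f p x = k p (g x)"
    using R_factorizable_prod_common_factor[OF assms(1-4)] by metis
  obtain \<B> where \<B>: "countable \<B>" "\<And>V. V \<in> \<B> \<Longrightarrow> openin X' V"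
    "\<And>U x. openin X' U \<Longrightarrow> x \<in> U \<Longrightarrow> \<exists>V\<in>\<B>. x \<in> V \<and> V \<subseteq> U"
    using X' unfolding second_countable_def by metis
  show ?thesis
  proof (intro exI[of _ "(\<lambda>V. {x \<in> topspace X. g x \<in> V}) ` \<B>"] conjI ballI allI impI)
    show "openin X C" if "C \<in> (\<lambda>V. {x \<in> topspace X. g x \<in> V}) ` \<B>" for C
      using that \<B>(2) g openin_continuous_map_preimage by blast
    fix A U x assume P: "(A, U) \<in> P" and x: "x \<in> A"
    \<comment> \<open>The threshold 1/2 lies between the values at least 1 on \<open>A\<close> and
      the value 0 off \<open>U\<close>.\<close>
    let ?W = "{z \<in> topspace X'. k (A, U) z \<in> {1/2<..}}"
    have xX: "x \<in> topspace X" "1 \<le> f (A, U) x"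
      using f P x by auto
    have "openin X' ?W"
      using k[OF P] by (rule openin_continuous_map_preimage) auto
    moreover have "g x \<in> ?W"
      using g xX fk[OF P xX(1)] by (auto simp: continuous_map_def)
    ultimately obtain V where V: "V \<in> \<B>" "g x \<in> V" "V \<subseteq> ?W"
      using \<B>(3)[of ?W "g x"] by blast
    have "z \<in> U" if z: "z \<in> topspace X" "g z \<in> V" for z
    proof (rule ccontr)
      assume "z \<notin> U"
      then have "k (A, U) (g z) = 0"
        using f[OF P] fk[OF P z(1)] z(1) by auto
      with V(3) z(2) show False by auto
    qed
    then show "\<exists>C\<in>(\<lambda>V. {x \<in> topspace X. g x \<in> V}) ` \<B>. x \<in> C \<and> C \<subseteq> U"
      using V xX(1) by (intro bexI[of _ "{x \<in> topspace X. g x \<in> V}"]) auto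
  qed (use \<B>(1) in simp)
qed

subsection \<open>Countably refinable spaces\<close>

text \<open>Second countability tested on at most \<omega>1 pointed neighbourhoods at a time;
  without the bound on \<open>P\<close>, \<open>\<C>\<close> would be a countable base.\<close>

definition countably_refinable :: "'a topology \<Rightarrow> bool" where
  "countably_refinable Z \<longleftrightarrow>
    (\<forall>P. |P| \<le>o omega1 \<and> (\<forall>(x, U) \<in> P. openin Z U \<and> x \<in> U) \<longrightarrow>
      (\<exists>\<C>. countable \<C> \<and> (\<forall>C\<in>\<C>. openin Z C) \<and> (\<forall>(x, U) \<in> P. \<exists>C\<in>\<C>. x \<in> C \<and> C \<subseteq> U)))"

lemma countably_refinable_left_factor:
  assumes "completely_regular_space X" "completely_regular_space Y"
    and "R_factorizable_prod X Y" "\<not> pseudo_aleph1_compact Y"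
  shows "countably_refinable X"
  unfolding countably_refinable_def
proof (intro allI impI, elim conjE)
  fix P assume P: "|P| \<le>o omega1" "\<forall>(x, U) \<in> P. openin X U \<and> x \<in> U"
  let ?P = "(\<lambda>(x, U). ({x}, U)) ` P"
  have "|?P| \<le>o omega1"
    using P(1) card_of_image ordLeq_transitive by blast
  moreover have "\<exists>f. continuous_map X euclideanreal f \<and>
      (\<forall>x\<in>A. x \<in> topspace X \<and> 1 \<le> f x) \<and> (\<forall>x\<in>topspace X - U. f x = 0)" if AU: "(A, U) \<in> ?P" for A U
  proof -
    obtain x where x: "A = {x}" "(x, U) \<in> P"
      using AU by auto
    with P(2) have U: "openin X U" "x \<in> U"
      by auto
    then obtain f where "continuous_map X euclideanreal f" "f x = 1" "f ` (topspace X - U) \<subseteq> {0::real}"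
      using assms(1) completely_regular_space_gen_alt'[of 1 "0::real"] by (metis one_neq_zero)
    then show ?thesis
      using x(1) U openin_subset by (intro exI[of _ f]) (auto simp: image_subset_iff)
  qed
  ultimately have "\<exists>\<C>. countable \<C> \<and> (\<forall>C\<in>\<C>. openin X C) \<and>
      (\<forall>A U x. (A, U) \<in> ?P \<longrightarrow> x \<in> A \<longrightarrow> (\<exists>C\<in>\<C>. x \<in> C \<and> C \<subseteq> U))"
    by (rule countable_refinement_of_separated_pairs[OF assms(2-4)])
  then obtain \<C> where \<C>: "countable \<C>" "\<forall>C\<in>\<C>. openin X C"
    "\<forall>A U x. (A, U) \<in> ?P \<longrightarrow> x \<in> A \<longrightarrow> (\<exists>C\<in>\<C>. x \<in> C \<and> C \<subseteq> U)"
    by (elim exE conjE) (rule that; assumption)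
  have "\<exists>C\<in>\<C>. x \<in> C \<and> C \<subseteq> U" if "(x, U) \<in> P" for x U
    using that by (intro \<C>(3)[rule_format, of "{x}"]) force+
  then show "\<exists>\<C>. countable \<C> \<and> (\<forall>C\<in>\<C>. openin X C) \<and> (\<forall>(x, U) \<in> P. \<exists>C\<in>\<C>. x \<in> C \<and> C \<subseteq> U)"
    using \<C>(1,2) by (intro exI[of _ \<C>]) auto
qed

text \<open>Shrink each neighbourhood to a basic box and refine all its coordinates at once in
  \<open>X\<close>; this is still at most \<omega>1 * \<omega> = \<omega>1 pairs.\<close>

lemma countably_refinable_power:
  assumes "countably_refinable X"
  shows "countably_refinable (product_topology (\<lambda>_::nat. X) UNIV)"
  unfolding countably_refinable_def
proof (intro allI impI, elim conjE)
  let ?Z = "product_topology (\<lambda>_::nat. X) UNIV"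
  fix P assume P: "|P| \<le>o omega1" "\<forall>(z, U) \<in> P. openin ?Z U \<and> z \<in> U"
  have "\<exists>B. finite {n. B n \<noteq> topspace X} \<and> (\<forall>n. openin X (B n)) \<and> fst p \<in> Pi UNIV B \<and> Pi UNIV B \<subseteq> snd p"
    if "p \<in> P" for p
    using that P(2) by (force simp: openin_product_topology_alt PiE_UNIV_domain)
  then obtain B where B: "\<And>p. p \<in> P \<Longrightarrow> finite {n. B p n \<noteq> topspace X} \<and> (\<forall>n. openin X (B p n)) \<and>
      fst p \<in> Pi UNIV (B p) \<and> Pi UNIV (B p) \<subseteq> snd p"
    by metis
  let ?P = "(\<lambda>(p, n). (fst p n, B p n)) ` (P \<times> UNIV)"
  have "|P \<times> (UNIV :: nat set)| \<le>o omega1"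
    by (rule card_of_Times_ordLeq_infinite_Field[OF infinite_Field_omega1 P(1) _ Card_order_omega1])
      (simp add: countable_imp_ordLeq_omega1)
  then have "|?P| \<le>o omega1"
    using card_of_image ordLeq_transitive by blast
  moreover have "\<forall>(x, U) \<in> ?P. openin X U \<and> x \<in> U"
    using B by (auto simp: Pi_iff)
  ultimately obtain \<C> where \<C>: "countable \<C>" "\<forall>C\<in>\<C>. openin X C" "\<forall>(x, U) \<in> ?P. \<exists>C\<in>\<C>. x \<in> C \<and> C \<subseteq> U"
    using assms unfolding countably_refinable_def by meson
  \<comment> \<open>A list constrains the coordinates below its length and leaves the others free.
    Over a countable \<open>\<C>\<close> there are only countably many lists.\<close>
  define box where "box = (\<lambda>l. Pi UNIV (\<lambda>n. if n < length l then l ! n else topspace X))"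
  have "openin ?Z (box l)" if "l \<in> lists \<C>" for l
  proof -
    have "finite {n. (if n < length l then l ! n else topspace X) \<noteq> topspace X}"
      by (rule finite_subset[of _ "{..<length l}"]) auto
    then show ?thesis
      using that \<C>(2) unfolding box_def PiE_UNIV_domain[symmetric]
      by (subst openin_PiE_gen) (auto simp: in_lists_conv_set)
  qed
  moreover have "\<exists>l\<in>lists \<C>. z \<in> box l \<and> box l \<subseteq> U" if zU: "(z, U) \<in> P" for z U
  proof -
    let ?B = "B (z, U)"
    have "\<exists>C\<in>\<C>. z n \<in> C \<and> C \<subseteq> ?B n" for n
      using \<C>(3) zU by force
    then obtain c where c: "\<And>n. c n \<in> \<C> \<and> z n \<in> c n \<and> c n \<subseteq> ?B n"
      by metis
    \<comment> \<open>Only finitely many coordinates of \<open>?B\<close> are proper, so a list of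
      length \<open>m\<close> reaches all of them.\<close>
    obtain m where m: "\<And>n. ?B n \<noteq> topspace X \<Longrightarrow> n < m"
      using B[OF zU] finite_nat_set_iff_bounded by auto
    let ?l = "map c [0..<m]"
    have "z n \<in> topspace X" for n
      using c \<C>(2) openin_subset by blast
    then have "z \<in> box ?l"
      using c by (auto simp: box_def)
    moreover have "box ?l \<subseteq> Pi UNIV ?B"
      unfolding box_def
    proof (rule Pi_mono)
      show "(if n < length ?l then ?l ! n else topspace X) \<subseteq> ?B n" for n
        using c m by (cases "n < m") auto
    qed
    moreover have "?l \<in> lists \<C>"
      using c by auto
    moreover have "Pi UNIV ?B \<subseteq> U"
      using B[OF zU] by simp
    ultimately show ?thesis
      by blast
  qed
  ultimately show "\<exists>\<D>. countable \<D> \<and> (\<forall>D\<in>\<D>. openin ?Z D) \<and> (\<forall>(z, U) \<in> P. \<exists>D\<in>\<D>. z \<in> D \<and> D \<subseteq> U)"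
    using \<C>(1) by (intro exI[of _ "box ` lists \<C>"]) fastforce
qed

text \<open>Otherwise recursion along \<open>\<omega>\<^sub>1\<close> yields uncountably many members of \<open>T\<close> no earlier one of
  which is \<open>R\<close>-related to a later one; but two of them have the same refining set, so each contains
  the point of the other.\<close>

lemma countably_refinable_countable_subfamily:
  assumes "countably_refinable Z" and T: "\<And>x U. (x, U) \<in> T \<Longrightarrow> openin Z U \<and> x \<in> U"
    and R: "\<And>x U y V. x \<in> V \<Longrightarrow> y \<in> U \<Longrightarrow> R (x, U) (y, V)"
  shows "\<exists>A\<subseteq>T. countable A \<and> (\<forall>t\<in>T. \<exists>s\<in>A. R s t)"
proof (rule ccontr)
  assume none: "\<not> ?thesis"
  have "\<exists>t\<in>T. \<forall>s\<in>A. \<not> R s t" if "countable A" "A \<subseteq> T" for A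
    using none that by meson
  then obtain p where p: "\<And>\<alpha>. p \<alpha> \<in> T" "\<And>\<alpha> s. s \<in> p ` underS omega1 \<alpha> \<Longrightarrow> \<not> R s (p \<alpha>)"
    using omega1_recursion[of T "\<lambda>A t. \<forall>s\<in>A. \<not> R s t"] by metis
  let ?F = "Field omega1"
  have "|p ` ?F| \<le>o omega1"
    using card_of_image card_of_Field_ordIso[OF Card_order_omega1] ordLeq_ordIso_trans by blast
  moreover have "\<forall>(x, U) \<in> p ` ?F. openin Z U \<and> x \<in> U"
    using p(1) T by (metis (no_types, lifting) case_prodI2 imageE)
  ultimately obtain \<C> where \<C>: "countable \<C>" "\<forall>(x, U) \<in> p ` ?F. \<exists>C\<in>\<C>. x \<in> C \<and> C \<subseteq> U"
    using assms(1) unfolding countably_refinable_def by meson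
  then have "\<exists>C\<in>\<C>. fst (p \<alpha>) \<in> C \<and> C \<subseteq> snd (p \<alpha>)" if "\<alpha> \<in> ?F" for \<alpha>
    using that by (fastforce simp: case_prod_beta)
  then obtain c where c: "\<And>\<alpha>. \<alpha> \<in> ?F \<Longrightarrow> c \<alpha> \<in> \<C> \<and> fst (p \<alpha>) \<in> c \<alpha> \<and> c \<alpha> \<subseteq> snd (p \<alpha>)"
    by metis
  have "\<not> inj_on c ?F"
  proof
    assume "inj_on c ?F"
    moreover have "countable (c ` ?F)"
      by (rule countable_subset[OF _ \<C>(1)]) (use c in auto)
    ultimately show False
      using countable_image_inj_on uncountable_Field_omega1 by blast
  qed
  then obtain \<alpha> \<beta> where ab: "\<alpha> \<in> ?F" "\<beta> \<in> ?F" "\<alpha> \<noteq> \<beta>" "c \<alpha> = c \<beta>"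
    unfolding inj_on_def by blast
  \<comment> \<open>Both directions are derived because either index may be the earlier one.\<close>
  have "R (p \<alpha>) (p \<beta>)" "R (p \<beta>) (p \<alpha>)"
    using R[of "fst (p \<alpha>)" "snd (p \<beta>)" "fst (p \<beta>)" "snd (p \<alpha>)"]
      R[of "fst (p \<beta>)" "snd (p \<alpha>)" "fst (p \<alpha>)" "snd (p \<beta>)"] c[OF ab(1)] c[OF ab(2)] ab(4)
    by auto
  moreover have "\<alpha> \<in> underS omega1 \<beta> \<or> \<beta> \<in> underS omega1 \<alpha>"
    using Card_order_omega1 ab(1-3)
    by (auto simp: card_order_on_def well_order_on_def linear_order_on_def total_on_def underS_def)
  ultimately show False
    using p(2) by blast
qed

section \<open>Hereditary Lindelof property and hereditary separability\<close>

lemma countably_refinable_imp_hereditarily_Lindelof: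
  assumes "countably_refinable Z"
  shows "hereditarily Lindelof_space Z"
  unfolding hereditarily_def Lindelof_space_def
proof (intro allI impI, elim conjE)
  fix S \<U> assume S: "S \<subseteq> topspace Z" and \<U>: "\<forall>U\<in>\<U>. openin (subtopology Z S) U"
    and cover: "\<Union>\<U> = topspace (subtopology Z S)"
  have top: "topspace (subtopology Z S) = S"
    using S by auto
  \<comment> \<open>Relatively open sets are replaced by open sets of \<open>Z\<close> with the same
    trace, so that refinability of \<open>Z\<close> itself applies to every subspace.\<close>
  let ?T = "{(x, V). openin Z V \<and> x \<in> V \<inter> S \<and> V \<inter> S \<in> \<U>}"
  \<comment> \<open>With this relation, an uncountable failure would be a right-separated family: no
    earlier neighbourhood contains a later point.\<close>
  have "\<exists>A\<subseteq>?T. countable A \<and> (\<forall>t\<in>?T. \<exists>s\<in>A. fst t \<in> snd s)"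
    by (rule countably_refinable_countable_subfamily[OF assms]) auto
  then obtain A where A: "A \<subseteq> ?T" "countable A" "\<forall>t\<in>?T. \<exists>s\<in>A. fst t \<in> snd s"
    by blast
  let ?\<V> = "(\<lambda>s. snd s \<inter> S) ` A"
  have "?\<V> \<subseteq> \<U>"
    using A(1) by auto
  moreover have "x \<in> \<Union>?\<V>" if "x \<in> S" for x
  proof -
    obtain U where U: "U \<in> \<U>" "x \<in> U"
      using \<open>x \<in> S\<close> cover top by blast
    then obtain V where "openin Z V" "U = V \<inter> S"
      using \<U> by (metis openin_subtopology)
    with U that have "(x, V) \<in> ?T"
      by auto
    then show ?thesis
      using A(3) that by fastforce
  qed
  ultimately show "\<exists>\<V>. countable \<V> \<and> \<V> \<subseteq> \<U> \<and> \<Union>\<V> = topspace (subtopology Z S)"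
    using A(2) top by (intro exI[of _ ?\<V>]) auto
qed

lemma countably_refinable_imp_hereditarily_separable:
  assumes "countably_refinable Z"
  shows "hereditarily separable_space Z"
  unfolding hereditarily_def separable_space_def
proof (intro allI impI)
  fix S assume S: "S \<subseteq> topspace Z"
  let ?T = "{(x, V). openin Z V \<and> x \<in> V \<inter> S}"
  \<comment> \<open>The dual relation excludes left-separated families, in which no later
    neighbourhood contains an earlier point. The points of \<open>A\<close> are then dense in
    \<open>S\<close>.\<close>
  have "\<exists>A\<subseteq>?T. countable A \<and> (\<forall>t\<in>?T. \<exists>s\<in>A. fst s \<in> snd t)"
    by (rule countably_refinable_countable_subfamily[OF assms]) auto
  then obtain A where A: "A \<subseteq> ?T" "countable A" "\<forall>t\<in>?T. \<exists>s\<in>A. fst s \<in> snd t"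
    by blast
  have sub: "fst ` A \<subseteq> S"
    using A(1) by auto
  have "\<exists>y\<in>fst ` A. y \<in> V" if "x \<in> S" "x \<in> V" "openin Z V" for x V
    using A(3) that by fastforce
  then have "S \<subseteq> Z closure_of (fst ` A)"
    using S by (auto simp: in_closure_of)
  then have "subtopology Z S closure_of (fst ` A) = topspace (subtopology Z S)"
    using sub S by (simp add: closure_of_subtopology Int_absorb1 Int_absorb2)
  then show "\<exists>C. countable C \<and> C \<subseteq> topspace (subtopology Z S) \<and>
      subtopology Z S closure_of C = topspace (subtopology Z S)"
    using A(2) sub S by (intro exI[of _ "fst ` A"]) auto
qed

subsection \<open>Weight\<close>

text \<open>A base of size at most \<omega>1 has at most \<omega>1 functionally separated pairs, so
  one countable \<open>\<C>\<close> refines them all. Every point and neighbourhood admit such a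
  pair between them, which makes \<open>\<C>\<close> a base.\<close>

lemma second_countable_left_factor:
  assumes "completely_regular_space X" "completely_regular_space Y"
    and "R_factorizable_prod X Y" "\<not> pseudo_aleph1_compact Y"
    and "weight X \<le>o omega1"
  shows "second_countable X"
proof -
  obtain \<B> where base: "is_base X \<B>" and card: "|\<B>| \<le>o omega1"
    using assms(5) weight_ordLeq_iff by blast
  define sep where "sep = (\<lambda>A U. \<exists>f. continuous_map X euclideanreal f \<and>
      (\<forall>x\<in>A. x \<in> topspace X \<and> 1 \<le> f x) \<and> (\<forall>x\<in>topspace X - U. f x = (0::real)))"
  let ?P = "{(A, U) \<in> \<B> \<times> \<B>. sep A U}"
  have "|\<B> \<times> \<B>| \<le>o omega1"
    using card_of_Times_ordLeq_infinite_Field[OF infinite_Field_omega1 card card Card_order_omega1] .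
  moreover have "|?P| \<le>o |\<B> \<times> \<B>|"
    by (rule card_of_mono1) auto
  ultimately have "|?P| \<le>o omega1"
    using ordLeq_transitive by blast
  then have "\<exists>\<C>. countable \<C> \<and> (\<forall>C\<in>\<C>. openin X C) \<and>
      (\<forall>A U x. (A, U) \<in> ?P \<longrightarrow> x \<in> A \<longrightarrow> (\<exists>C\<in>\<C>. x \<in> C \<and> C \<subseteq> U))"
    by (rule countable_refinement_of_separated_pairs[OF assms(2-4)]) (auto simp: sep_def)
  then obtain \<C> where \<C>: "countable \<C>" "\<forall>C\<in>\<C>. openin X C"
    "\<forall>A U x. (A, U) \<in> ?P \<longrightarrow> x \<in> A \<longrightarrow> (\<exists>C\<in>\<C>. x \<in> C \<and> C \<subseteq> U)"
    by (elim exE conjE) (rule that; assumption)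
  have "\<exists>C\<in>\<C>. x \<in> C \<and> C \<subseteq> W" if W: "openin X W" "x \<in> W" for W x
  proof -
    obtain U where U: "U \<in> \<B>" "x \<in> U" "U \<subseteq> W" "openin X U"
      using base W unfolding is_base_def by blast
    \<comment> \<open>The value 2 puts \<open>x\<close> inside the open set where \<open>f\<close>
      exceeds 1, and any base member \<open>A\<close> within that set satisfies the bound in
      \<open>sep\<close>.\<close>
    obtain f where f: "continuous_map X euclideanreal f" "f x = 2" "f ` (topspace X - U) \<subseteq> {0::real}"
      using assms(1) U completely_regular_space_gen_alt'[of 2 "0::real"] by (metis zero_neq_numeral)
    let ?O = "{z \<in> topspace X. f z \<in> {1<..}}"
    have "openin X ?O"
      using f(1) by (rule openin_continuous_map_preimage) auto
    moreover have "x \<in> ?O"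
      using f(2) U openin_subset by fastforce
    ultimately obtain A where A: "A \<in> \<B>" "x \<in> A" "A \<subseteq> ?O"
      using base unfolding is_base_def by blast
    have "sep A U"
      unfolding sep_def using f A(3) by (intro exI[of _ f]) (auto simp: image_subset_iff)
    then have "(A, U) \<in> ?P"
      using A(1) U(1) by auto
    then show ?thesis
      using \<C>(3) A(2) U(3) by (meson order_trans)
  qed
  then show ?thesis
    unfolding second_countable_def using \<C>(1,2) by blast
qed

text \<open>Regularity makes the sets int cl U, for open U, a base. With \<open>D\<close> dense, cl
  U is determined by the trace of U on \<open>D\<close>, so subsets of \<open>D\<close> index this
  base.\<close>

lemma weight_separable_regular:
  assumes "separable_space X" "regular_space X"
  shows "weight X \<le>o |UNIV :: nat set set|"
proof -
  obtain D where D: "countable D" "D \<subseteq> topspace X" "X closure_of D = topspace X"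
    using assms(1) unfolding separable_space_def by blast
  let ?B = "(\<lambda>E. X interior_of (X closure_of E)) ` Pow D"
  have "is_base X ?B"
    unfolding is_base_def
  proof (intro conjI ballI allI impI)
    show "openin X B" if "B \<in> ?B" for B
      using that by auto
    fix W x assume "openin X W \<and> x \<in> W"
    then obtain U C where U: "openin X U" "x \<in> U" and "closedin X C" "U \<subseteq> C" "C \<subseteq> W"
      using assms(2) unfolding neighbourhood_base_of_closedin[symmetric] neighbourhood_base_of by metis
    then have cl: "X closure_of U \<subseteq> W"
      by (meson closure_of_minimal order_trans)
    have "X closure_of (U \<inter> D) = X closure_of U"
      using D U(1) openin_subset by (metis closure_of_openin_Int_superset)
    then have "x \<in> X interior_of (X closure_of (U \<inter> D))"
      using U closure_of_subset interior_of_maximal openin_subset by (metis subsetD)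
    moreover have "X interior_of (X closure_of (U \<inter> D)) \<subseteq> W"
      using \<open>X closure_of (U \<inter> D) = X closure_of U\<close> cl interior_of_subset by (metis order_trans)
    ultimately show "\<exists>B\<in>?B. x \<in> B \<and> B \<subseteq> W"
      by blast
  qed
  moreover have "|?B| \<le>o |UNIV :: nat set set|"
  proof -
    obtain e :: "'a \<Rightarrow> nat" where "inj_on e D"
      using D(1) by (rule countableE)
    \<comment> \<open>Taking images under \<open>e\<close> embeds the subsets of \<open>D\<close>
      into the sets of naturals.\<close>
    then have "inj_on ((`) e) (Pow D)"
      by (rule inj_on_image_Pow)
    then have "|Pow D| \<le>o |UNIV :: nat set set|"
      by (meson card_of_ordLeq subset_UNIV)
    then show ?thesis
      using card_of_image ordLeq_transitive by blast
  qed
  ultimately show ?thesis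
    using weight_ordLeq_iff by blast
qed

theorem theorem5:
  fixes X :: "'a topology" and Y :: "'b topology"
  assumes "tychonoff_space X" and "tychonoff_space Y"
    and "R_factorizable_prod X Y"
    and "\<not> pseudo_aleph1_compact Y"
  shows "(hereditarily Lindelof_space (product_topology (\<lambda>_ :: nat. X) UNIV) \<and>
          hereditarily separable_space (product_topology (\<lambda>_ :: nat. X) UNIV)) \<and>
         (weight X \<le>o omega1 \<longrightarrow> second_countable X) \<and>
         (CH \<longrightarrow> second_countable X)"
proof (intro conjI impI)
  have cr: "completely_regular_space X" "completely_regular_space Y"
    using assms(1,2) by (auto simp: tychonoff_space_def)
  have ref: "countably_refinable X"
    using countably_refinable_left_factor[OF cr assms(3,4)] .
  show "hereditarily Lindelof_space (product_topology (\<lambda>_ :: nat. X) UNIV)"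
    "hereditarily separable_space (product_topology (\<lambda>_ :: nat. X) UNIV)"
    using countably_refinable_power[OF ref] countably_refinable_imp_hereditarily_Lindelof
      countably_refinable_imp_hereditarily_separable by blast+
  show sc: "second_countable X" if "weight X \<le>o omega1"
    using second_countable_left_factor[OF cr assms(3,4) that] .
  \<comment> \<open>Under \<open>CH\<close> the continuum bound on the weight of a separable regular
    space becomes the bound \<open>omega1\<close>, which reduces this claim to the previous
    one.\<close>
  assume CH
  have "separable_space X"
    using countably_refinable_imp_hereditarily_separable[OF ref]
    by (metis hereditarily_def order_refl subtopology_topspace)
  then have "weight X \<le>o |UNIV :: nat set set|"
    using cr(1) by (simp add: completely_regular_imp_regular_space weight_separable_regular)
  then have "weight X \<le>o omega1"
    using \<open>CH\<close> ordLeq_ordIso_trans unfolding CH_def by blast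
  then show "second_countable X"
    by (rule sc)
qed

end
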